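(* Let $H:\mathbb{R}^n\to\mathbb{R}^d$ and $K:\mathbb{R}^n\to\mathbb{R}^e$ be linear mappings with $\mathcal{N}(H)\cap\mathcal{N}(K)=\{0\}$, and let $\phi:\mathbb{R}^d\to[-\infty,+\infty]$ and $\psi:\mathbb{R}^e\to[-\infty,+\infty]$ be proper, lower semicontinuous and coercive. Then the mapping $h:\mathbb{R}^n\to[-\infty,+\infty]$, $h(x):=\phi(Hx)+\psi(Kx)$, is lower semicontinuous and coercive. In particular, $h$ attains its infimum $\inf h\in[-\infty,+\infty]$ at some point of $\mathbb{R}^n$.
   Context: $\mathcal{N}$ denotes the nullspace. A function into $[-\infty,+\infty]$ is proper if it never takes the value $-\infty$ and is not identically $+\infty$. A function $f:\mathbb{R}^k\to[-\infty,+\infty]$ is coercive iff $f(x)\to+\infty$ as $\|x\|\to+\infty$. Convention: $-\infty+(+\infty)=+\infty+(-\infty)=-\infty$ (this case does not occur under the hypotheses). *)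

theory Defs
  imports "HOL-Analysis.Analysis"
begin

definition proper_fun :: "('a \<Rightarrow> ereal) \<Rightarrow> bool" where
  "proper_fun f \<longleftrightarrow> (\<forall>x. f x \<noteq> -\<infinity>) \<and> (\<exists>x. f x \<noteq> \<infinity>)"

definition lower_semicontinuous :: "('a::topological_space \<Rightarrow> ereal) \<Rightarrow> bool" where
  "lower_semicontinuous f \<longleftrightarrow> (\<forall>x. \<forall>a < f x. \<forall>\<^sub>F y in nhds x. a < f y)"

definition coercive :: "('a::real_normed_vector \<Rightarrow> ereal) \<Rightarrow> bool" where
  "coercive f \<longleftrightarrow> (f \<longlongrightarrow> \<infinity>) at_infinity"

(* On type ereal the library addition satisfies -\<infinity> + \<infinity> = \<infinity>.  The operation below
   differs from it exactly in that -\<infinity> is absorbing, so that the mixed sums are -\<infinity>. *)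
definition lower_add :: "ereal \<Rightarrow> ereal \<Rightarrow> ereal"  (infixl "+\<^sub>l" 65) where
  "a +\<^sub>l b = (if a = -\<infinity> \<or> b = -\<infinity> then -\<infinity> else a + b)"

lemma lower_add_eq_plus:
  assumes "a \<noteq> -\<infinity>" "b \<noteq> -\<infinity>"
  shows "a +\<^sub>l b = a + b"
  using assms by (simp add: lower_add_def)

end

theory Submission
  imports Defs
begin

text \<open>
  The trivial intersection of the null spaces makes the pairing of \<open>H\<close> and \<open>K\<close> injective, so its
  norm dominates a positive multiple of the norm of its argument. As \<open>\<phi>\<close> and \<open>\<psi>\<close> attain their
  infima, both are bounded below by real constants, so the sum is large as soon as one of the two
  summands is.
\<close>

lemma lower_semicontinuous_compose:
  assumes "lower_semicontinuous f" and "continuous_on UNIV T"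
  shows "lower_semicontinuous (\<lambda>x. f (T x))"
  unfolding lower_semicontinuous_def
proof (intro allI impI)
  fix x a
  assume "a < f (T x)"
  then have "\<forall>\<^sub>F y in nhds (T x). a < f y"
    using assms(1) by (simp add: lower_semicontinuous_def)
  moreover have "filterlim T (nhds (T x)) (nhds x)"
    using assms(2)
    by (metis UNIV_I continuous_on_def tendsto_at_iff_tendsto_nhds)
  ultimately show "\<forall>\<^sub>F y in nhds x. a < f (T y)"
    by (auto simp: filterlim_iff)
qed

lemma lower_semicontinuous_closed_sublevel:
  assumes "lower_semicontinuous f"
  shows "closed {x. f x \<le> a}"
proof -
  have "open {x. a < f x}"
    using assms unfolding lower_semicontinuous_def
    by (subst open_subopen) (fastforce simp: eventually_nhds)
  moreover have "- {x. f x \<le> a} = {x. a < f x}"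
    by auto
  ultimately show ?thesis
    by (simp add: closed_def)
qed

lemma coercive_iff:
  "coercive f \<longleftrightarrow> (\<forall>r::real. \<exists>b. \<forall>x. b \<le> norm x \<longrightarrow> ereal r < f x)"
  by (simp add: coercive_def tendsto_PInfty eventually_at_infinity)

text \<open>Injectivity gives \<open>B > 0\<close> with \<open>B * norm x \<le> norm (T x)\<close>,
  so points far from the origin are mapped far from the origin.\<close>

lemma coercive_linear_inj:
  fixes T :: "'a::euclidean_space \<Rightarrow> 'b::euclidean_space"
  assumes "coercive f" and "linear T" and "inj T"
  shows "coercive (\<lambda>x. f (T x))"
  unfolding coercive_iff
proof
  fix r :: real
  obtain b where b: "\<And>y. b \<le> norm y \<Longrightarrow> ereal r < f y"
    using assms(1) by (auto simp: coercive_iff)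
  obtain B where B: "B > 0" "\<And>x. B * norm x \<le> norm (T x)"
    using linear_inj_bounded_below_pos[OF assms(2,3)] by metis
  have "ereal r < f (T x)" if "b / B \<le> norm x" for x
  proof (rule b)
    have "b \<le> B * norm x"
      using that B(1) by (simp add: field_simps)
    then show "b \<le> norm (T x)"
      using B(2)[of x] by simp
  qed
  then show "\<exists>b. \<forall>x. b \<le> norm x \<longrightarrow> ereal r < f (T x)"
    by blast
qed

text \<open>If the infimum is below \<infinity>, the sublevel sets at levels above it are closed,
  and finitely many of them always meet inside one fixed closed ball. By compactness they have a
  common point, which is a minimiser.\<close>

lemma lower_semicontinuous_coercive_attains_INF:
  fixes f :: "'a::{real_normed_vector, heine_borel} \<Rightarrow> ereal"
  assumes "lower_semicontinuous f" and "coercive f"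
  shows "\<exists>x. f x = (INF y. f y)"
proof (cases "(INF y. f y) = \<infinity>")
  \<comment> \<open>Here \<open>f\<close> is constantly \<infinity>, so every point is a
    minimiser.\<close>
  case True
  then have "f x = \<infinity>" for x
    by (metis INF_lower UNIV_I ereal_infty_less_eq(1))
  then show ?thesis by simp
next
  case False
  define m where "m = (INF y. f y)"
  have "m < \<infinity>" using False by (simp add: m_def)
  \<comment> \<open>A real level above the infimum: by coercivity its sublevel set lies in
    \<open>cball 0 b\<close>.\<close>
  then obtain r where r: "m < ereal r"
    using ereal_dense2 by blast
  obtain b where b: "\<And>x. b \<le> norm x \<Longrightarrow> ereal r < f x"
    using assms(2) by (auto simp: coercive_iff)
  have "cball 0 b \<inter> \<Inter>((\<lambda>a. {x. f x \<le> a}) ` {m<..}) \<noteq> {}"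
  proof (rule compact_imp_fip)
    show "closed C" if "C \<in> (\<lambda>a. {x. f x \<le> a}) ` {m<..}" for C
      using that lower_semicontinuous_closed_sublevel[OF assms(1)] by auto
    fix F'
    assume "finite F'" "F' \<subseteq> (\<lambda>a. {x. f x \<le> a}) ` {m<..}"
    then obtain A where A: "finite A" "A \<subseteq> {m<..}" "F' = (\<lambda>a. {x. f x \<le> a}) ` A"
      by (meson finite_subset_image)
    \<comment> \<open>Inserting \<open>ereal r\<close> forces the point found below into the ball
      and covers the case of empty \<open>A\<close>.\<close>
    have "m < Min (insert (ereal r) A)"
      using A r by auto
    then obtain x where x: "f x < Min (insert (ereal r) A)"
      by (auto simp: m_def INF_less_iff)
    then have "f x < ereal r" "\<forall>a\<in>A. f x \<le> a"
      using A(1) by auto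
    then have "x \<in> cball 0 b \<inter> \<Inter>F'"
      using A(3) b[of x] by fastforce
    then show "cball 0 b \<inter> \<Inter>F' \<noteq> {}" by blast
  qed simp
  then obtain x where "\<And>a. m < a \<Longrightarrow> f x \<le> a" by auto
  then have "f x \<le> m" by (rule dense_ge)
  moreover have "m \<le> f x" by (simp add: m_def INF_lower)
  ultimately have "f x = m" by (rule antisym)
  then show ?thesis unfolding m_def by blast
qed

text \<open>The infimum is a value of \<open>f\<close>, hence not -\<infinity>, and any real number
  below it is a lower bound.\<close>

lemma proper_coercive_bounded_below:
  fixes f :: "'a::{real_normed_vector, heine_borel} \<Rightarrow> ereal"
  assumes "proper_fun f" and "lower_semicontinuous f" and "coercive f"
  obtains m :: real where "\<And>x. ereal m \<le> f x"
proof -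
  obtain x0 where x0: "f x0 = (INF y. f y)"
    using lower_semicontinuous_coercive_attains_INF[OF assms(2,3)] by blast
  have "-\<infinity> < f x0" using assms(1) by (auto simp: proper_fun_def)
  then obtain m where "ereal m < f x0"
    using ereal_dense2 by blast
  then have "ereal m \<le> f x" for x
    using x0 by (metis INF_lower UNIV_I less_imp_le order_trans)
  then show thesis by (rule that)
qed

text \<open>Turns a strict lower bound on a sum into strict bounds on the summands, to which
  semicontinuity applies separately.\<close>

lemma ereal_less_add_split:
  fixes F G :: ereal
  assumes "ereal a < F + G" and "F \<noteq> -\<infinity>" and "G \<noteq> -\<infinity>"
  obtains b c :: real where "ereal b < F" "ereal c < G" "a \<le> b + c"
proof (cases F)
  case (real u)
  show thesis
  proof (cases G)
    case (real v)
    \<comment> \<open>Each summand gives up half of the positive gap \<open>u + v - a\<close>, so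
      the two bounds add up to exactly \<open>a\<close>.\<close>
    then show thesis
      using that[of "u - (u + v - a) / 2" "v - (u + v - a) / 2"] assms(1) \<open>F = ereal u\<close>
      by (simp add: field_simps)
  next
    case PInf
    then show thesis
      using that[of "u - 1" "a - u + 1"] real by simp
  qed (use assms in simp)
next
  case PInf
  obtain c where "ereal c < G"
    using ereal_dense2[of "-\<infinity>" G] assms(3) by auto
  then show thesis
    using that[of "a - c" c] PInf by simp
qed (use assms in simp)

lemma lower_semicontinuous_add:
  assumes "lower_semicontinuous f" and "lower_semicontinuous g"
    and "\<And>x. f x \<noteq> -\<infinity>" and "\<And>x. g x \<noteq> -\<infinity>"
  shows "lower_semicontinuous (\<lambda>x. f x + g x)"
  unfolding lower_semicontinuous_def
proof (intro allI impI)
  fix x a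
  assume a: "a < f x + g x"
  show "\<forall>\<^sub>F y in nhds x. a < f y + g y"
  proof (cases a)
    case (real r)
    obtain b c where bc: "ereal b < f x" "ereal c < g x" "r \<le> b + c"
      using ereal_less_add_split a assms(3,4) real by metis
    then have "\<forall>\<^sub>F y in nhds x. ereal b < f y" "\<forall>\<^sub>F y in nhds x. ereal c < g y"
      using assms(1,2) by (simp_all add: lower_semicontinuous_def)
    then show ?thesis
    proof eventually_elim
      case (elim y)
      have "a \<le> ereal b + ereal c" using real bc(3) by simp
      also have "\<dots> < f y + g y" by (rule ereal_add_strict_mono2[OF elim])
      finally show ?case .
    qed
  next
    case PInf
    then show ?thesis using a by simp
  next
    \<comment> \<open>Every \<open>y\<close> qualifies, because a sum of two values other than
      -\<infinity> is not -\<infinity>.\<close>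
    case MInf
    then show ?thesis using assms(3,4) by simp
  qed
qed

text \<open>A pair of large norm has a component of large norm; the summand there becomes large
  while the other stays above its constant.\<close>

lemma coercive_separable_add:
  fixes f :: "'a::real_normed_vector \<Rightarrow> ereal" and g :: "'b::real_normed_vector \<Rightarrow> ereal"
  assumes "coercive f" and "coercive g"
    and f: "\<And>x. ereal m \<le> f x" and g: "\<And>y. ereal k \<le> g y"
  shows "coercive (\<lambda>p. f (fst p) + g (snd p))"
  unfolding coercive_iff
proof
  fix r :: real
  \<comment> \<open>The thresholds \<open>r - k\<close> and \<open>r - m\<close> compensate for the
    lower bound of the other summand.\<close>
  obtain b where b: "\<And>x. b \<le> norm x \<Longrightarrow> ereal (r - k) < f x"
    using assms(1) by (auto simp: coercive_iff)
  obtain c where c: "\<And>y. c \<le> norm y \<Longrightarrow> ereal (r - m) < g y"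
    using assms(2) by (auto simp: coercive_iff)
  have "ereal r < f x + g y" if "b + c \<le> norm (x, y)" for x y
  proof -
    have "b \<le> norm x \<or> c \<le> norm y"
      using that norm_Pair_le[of x y] by linarith
    then consider "ereal (r - k) < f x" | "ereal (r - m) < g y"
      using b c by blast
    then show ?thesis
    proof cases
      case 1
      then show ?thesis
        using g[of y] by (cases "f x"; cases "g y") auto
    next
      case 2
      then show ?thesis
        using f[of x] by (cases "f x"; cases "g y") auto
    qed
  qed
  then show "\<exists>b. \<forall>p. b \<le> norm p \<longrightarrow> ereal r < f (fst p) + g (snd p)"
    by (intro exI[of _ "b + c"]) auto
qed

theorem lemma2p7p1:
  fixes H :: "real ^ 'n \<Rightarrow> real ^ 'd"
    and K :: "real ^ 'n \<Rightarrow> real ^ 'e"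
    and \<phi> :: "real ^ 'd \<Rightarrow> ereal"
    and \<psi> :: "real ^ 'e \<Rightarrow> ereal"
    and h :: "real ^ 'n \<Rightarrow> ereal"
  assumes "linear H" and "linear K"
    and "{x. H x = 0} \<inter> {x. K x = 0} = {0}"
    and "proper_fun \<phi>" and "lower_semicontinuous \<phi>" and "coercive \<phi>"
    and "proper_fun \<psi>" and "lower_semicontinuous \<psi>" and "coercive \<psi>"
    and "\<And>x. h x = \<phi> (H x) +\<^sub>l \<psi> (K x)"
  shows "lower_semicontinuous h \<and> coercive h \<and> (\<exists>x. h x = (INF y. h y))"
proof -
  have ninf: "\<phi> u \<noteq> -\<infinity>" "\<psi> v \<noteq> -\<infinity>" for u v
    using assms(4,7) by (auto simp: proper_fun_def)
  \<comment> \<open>Properness excludes the mixed infinite sums, so the two additions agree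
    here.\<close>
  then have h: "h = (\<lambda>x. \<phi> (H x) + \<psi> (K x))"
    using assms(10) by (auto simp: lower_add_eq_plus)
  have "continuous_on UNIV H" "continuous_on UNIV K"
    using assms(1,2) by (simp_all add: linear_continuous_on linear_conv_bounded_linear)
  then have "lower_semicontinuous (\<lambda>x. \<phi> (H x))" "lower_semicontinuous (\<lambda>x. \<psi> (K x))"
    using lower_semicontinuous_compose assms(5,8) by blast+
  then have lsc: "lower_semicontinuous h"
    unfolding h using ninf by (rule lower_semicontinuous_add)
  \<comment> \<open>\<open>H\<close> or \<open>K\<close> alone may have a nontrivial kernel, so
    coercivity is proved for the separable sum on the product space and pulled back along
    \<open>T\<close>, whose kernel is the intersection of the two.\<close>
  define T where "T x = (H x, K x)" for x
  have "linear T"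
    using assms(1,2) by (auto simp: T_def linear_iff)
  have "inj T"
    unfolding linear_injective_0[OF \<open>linear T\<close>] using assms(3) by (auto simp: T_def zero_prod_def)
  obtain m where m: "\<And>u. ereal m \<le> \<phi> u"
    using proper_coercive_bounded_below[OF assms(4-6)] by blast
  obtain k where k: "\<And>v. ereal k \<le> \<psi> v"
    using proper_coercive_bounded_below[OF assms(7-9)] by blast
  have "coercive (\<lambda>p. \<phi> (fst p) + \<psi> (snd p))"
    by (rule coercive_separable_add[OF assms(6,9) m k])
  from coercive_linear_inj[OF this \<open>linear T\<close> \<open>inj T\<close>]
  have "coercive h"
    by (simp add: h T_def)
  with lsc show ?thesis
    using lower_semicontinuous_coercive_attains_INF by blast
qed

end
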